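(* Let $\mathbb{K}$ be a field with $\operatorname{char}\mathbb{K}=0$. Then the bracket width of the Lie algebra of polynomial vector fields on $\mathrm{SL}_2(\mathbb{K})$ is at most $3$.
   Context: The Lie algebra of polynomial vector fields on $\mathrm{SL}_2(\mathbb{K})$ is the Lie algebra over $\mathbb{K}$ of $\mathbb{K}$-linear derivations of the coordinate ring $\mathbb{K}[a_{11},a_{12},a_{21},a_{22}]/(a_{11}a_{22}-a_{12}a_{21}-1)$, with the commutator bracket. For a Lie algebra $L$ and $z \in [L,L]$ (the derived algebra), let $\ell(z)$ be the smallest number $m$ such that $z = \sum_{i=1}^m [x_i,y_i]$ for some $x_i,y_i \in L$. The bracket width of $L$ is $\sup\{\ell(z) : z \in [L,L]\}$. *)

theory Defs
  imports Complex_Main "HOL-Library.Poly_Mapping" "HOL-Library.Function_Algebras"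
    "HOL-Library.Extended_Nat"
begin

section \<open>The coordinate ring of SL2\<close>

datatype entry = A11 | A12 | A21 | A22

text \<open>
  Exponent vectors are \<open>entry \<Rightarrow>\<^sub>0 nat\<close>, so polynomials in the four matrix entries are finitely
  supported functions from exponent vectors to coefficients; the ring structure (convolution)
  is that of \<open>HOL-Library.Poly_Mapping\<close>.
\<close>

type_synonym 'k entry_poly = "(entry \<Rightarrow>\<^sub>0 nat) \<Rightarrow>\<^sub>0 'k"

definition var :: "entry \<Rightarrow> 'k::comm_ring_1 entry_poly" where
  "var e = Poly_Mapping.single (Poly_Mapping.single e 1) 1"

definition const_poly :: "'k::comm_ring_1 \<Rightarrow> 'k entry_poly" where
  "const_poly c = Poly_Mapping.single 0 c"

definition sl2_relation :: "'k::comm_ring_1 entry_poly" where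
  "sl2_relation = var A11 * var A22 - var A12 * var A21 - 1"

text \<open>Two polynomials are identified iff their difference lies in the principal ideal generated
  by \<open>sl2_relation\<close>.\<close>

quotient_type (overloaded) 'k sl2_ring =
  "'k::comm_ring_1 entry_poly" / "\<lambda>p q. sl2_relation dvd p - q"
proof (rule equivpI)
  show "reflp (\<lambda>p q::'k entry_poly. sl2_relation dvd p - q)"
    by (simp add: reflp_def)
  show "symp (\<lambda>p q::'k entry_poly. sl2_relation dvd p - q)"
    by (metis (mono_tags, lifting) sympI minus_diff_eq dvd_minus_iff)
  show "transp (\<lambda>p q::'k entry_poly. sl2_relation dvd p - q)"
  proof (rule transpI)
    fix p q r :: "'k entry_poly"
    assume "sl2_relation dvd p - q" "sl2_relation dvd q - r"
    then have "sl2_relation dvd (p - q) + (q - r)" by (rule dvd_add)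
    then show "sl2_relation dvd p - r" by simp
  qed
qed

lemma entry_poly_induct:
  fixes p :: "'k::comm_ring_1 entry_poly"
  assumes "P 0" and "\<And>p m c. P p \<Longrightarrow> P (p + Poly_Mapping.single m c)"
  shows "P p"
proof (induction p rule: update_induct)
  case const
  then show ?case using assms(1) by (metis zero_poly_mapping_def)
next
  case (update f m c)
  have "Poly_Mapping.update m c f = f + Poly_Mapping.single m c"
    using update by (intro poly_mapping_eqI)
      (auto simp: lookup_update lookup_add lookup_single when_def in_keys_iff)
  then show ?case using assms(2) update by simp
qed

text \<open>The coordinate ring is not the zero ring: evaluation at the identity matrix kills
  \<open>sl2_relation\<close> but not 1.\<close>

lemma not_sl2_relation_dvd_one: "\<not> (sl2_relation :: 'k::comm_ring_1 entry_poly) dvd 1"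
proof
  define ev1 :: "(entry \<Rightarrow>\<^sub>0 nat) \<Rightarrow> 'k" where
    "ev1 m = (if Poly_Mapping.lookup m A12 = 0 \<and> Poly_Mapping.lookup m A21 = 0 then 1 else 0)" for m
  define ev :: "'k entry_poly \<Rightarrow> 'k" where
    "ev p = (\<Sum>m\<in>Poly_Mapping.keys p. Poly_Mapping.lookup p m * ev1 m)" for p
  have ev_superset: "ev p = (\<Sum>m\<in>S. Poly_Mapping.lookup p m * ev1 m)"
    if "finite S" "Poly_Mapping.keys p \<subseteq> S" for p S
    unfolding ev_def using that by (intro sum.mono_neutral_left) (auto simp: in_keys_iff)
  have ev_add: "ev (p + q) = ev p + ev q" for p q
  proof -
    have "finite (Poly_Mapping.keys p \<union> Poly_Mapping.keys q)"
      "Poly_Mapping.keys (p + q) \<subseteq> Poly_Mapping.keys p \<union> Poly_Mapping.keys q"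
      using Poly_Mapping.keys_add[of p q] by simp_all
    then show ?thesis
      by (simp add: ev_superset[of "Poly_Mapping.keys p \<union> Poly_Mapping.keys q"]
          lookup_add sum.distrib algebra_simps)
  qed
  have ev_0: "ev 0 = 0" by (simp add: ev_def)
  have ev_single: "ev (Poly_Mapping.single m c) = c * ev1 m" for m c
    using ev_superset[of "{m}" "Poly_Mapping.single m c"] by simp
  have ev_mult_single: "ev (p * Poly_Mapping.single m c) = ev p * (c * ev1 m)" for p m c
    by (induction p rule: entry_poly_induct)
      (auto simp: ev_0 ev_add ev_single distrib_right mult_single ev1_def lookup_add)
  have ev_mult: "ev (p * q) = ev p * ev q" for p q
    by (induction q rule: entry_poly_induct)
      (simp_all add: ev_0 ev_add ev_single ev_mult_single distrib_left)
  have ev_1: "ev 1 = 1"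
    using ev_single[of 0 1] by (simp add: ev1_def)
  have "ev (sl2_relation + 1) = 1"
    by (simp add: sl2_relation_def ev_mult var_def ev_single ev1_def lookup_single
        mult_single when_def lookup_add diff_conv_add_uminus ev_add single_uminus[symmetric]
        del: add_uminus_conv_diff)
  then have ev_rel: "ev sl2_relation = 0" by (simp add: ev_add ev_1)
  assume "(sl2_relation :: 'k entry_poly) dvd 1"
  then obtain q :: "'k entry_poly" where "1 = sl2_relation * q" by (elim dvdE)
  then have "ev 1 = ev sl2_relation * ev q" by (metis ev_mult)
  then show False by (simp add: ev_1 ev_rel)
qed

instantiation sl2_ring :: (comm_ring_1) comm_ring_1
begin

lift_definition zero_sl2_ring :: "'a sl2_ring" is 0 .

lift_definition plus_sl2_ring :: "'a sl2_ring \<Rightarrow> 'a sl2_ring \<Rightarrow> 'a sl2_ring" is "(+)"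
  by (metis add_diff_add dvd_add)

lift_definition uminus_sl2_ring :: "'a sl2_ring \<Rightarrow> 'a sl2_ring" is uminus
  by (metis dvd_diff_commute minus_diff_minus dvd_minus_iff)

lift_definition minus_sl2_ring :: "'a sl2_ring \<Rightarrow> 'a sl2_ring \<Rightarrow> 'a sl2_ring" is "(-)"
proof -
  fix p p' q q' :: "'a entry_poly"
  assume "sl2_relation dvd p - p'" "sl2_relation dvd q - q'"
  then have "sl2_relation dvd (p - p') - (q - q')" by (rule dvd_diff)
  then show "sl2_relation dvd p - q - (p' - q')" by (simp add: algebra_simps)
qed

lift_definition times_sl2_ring :: "'a sl2_ring \<Rightarrow> 'a sl2_ring \<Rightarrow> 'a sl2_ring" is "(*)"
proof -
  fix p p' q q' :: "'a entry_poly"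
  assume "sl2_relation dvd p - p'" "sl2_relation dvd q - q'"
  then have "sl2_relation dvd (p - p') * q + p' * (q - q')" by simp
  then show "sl2_relation dvd p * q - p' * q'" by (simp add: algebra_simps)
qed

lift_definition one_sl2_ring :: "'a sl2_ring" is 1 .

instance
proof
  show "(0 :: 'a sl2_ring) \<noteq> 1"
    by transfer (simp add: not_sl2_relation_dvd_one)
qed (transfer; simp add: algebra_simps)+

end

lift_definition sl2_scale :: "'k::comm_ring_1 \<Rightarrow> 'k sl2_ring \<Rightarrow> 'k sl2_ring"
  is "\<lambda>c p. const_poly c * p"
  by (metis dvd_mult right_diff_distrib)

lemma const_poly_simps:
  "const_poly 1 = 1"
  "const_poly (a + b) = const_poly a + const_poly b"
  "const_poly (a * b) = const_poly a * const_poly b"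
  by (simp_all add: const_poly_def single_add mult_single)

lemma vector_space_sl2_scale: "vector_space (sl2_scale :: 'k::field \<Rightarrow> _)"
  by standard (transfer; simp add: const_poly_simps algebra_simps)+


section \<open>Derivations\<close>

definition derivation :: "('k::field sl2_ring \<Rightarrow> 'k sl2_ring) \<Rightarrow> bool" where
  "derivation D \<longleftrightarrow>
     Vector_Spaces.linear sl2_scale sl2_scale D \<and> (\<forall>f g. D (f * g) = D f * g + f * D g)"

definition sl2_vector_fields :: "('k::field sl2_ring \<Rightarrow> 'k sl2_ring) set" where
  "sl2_vector_fields = {D. derivation D}"

definition vf_scale ::
  "'k::field \<Rightarrow> ('k sl2_ring \<Rightarrow> 'k sl2_ring) \<Rightarrow> ('k sl2_ring \<Rightarrow> 'k sl2_ring)" where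
  "vf_scale c D = (\<lambda>f. sl2_scale c (D f))"

definition commutator :: "('a \<Rightarrow> 'a) \<Rightarrow> ('a \<Rightarrow> 'a) \<Rightarrow> ('a \<Rightarrow> 'a::ab_group_add)" where
  "commutator D E = (\<lambda>f. D (E f) - E (D f))"

lemma vector_space_vf_scale: "vector_space (vf_scale :: 'k::field \<Rightarrow> _)"
proof -
  interpret vector_space "sl2_scale :: 'k \<Rightarrow> _" by (rule vector_space_sl2_scale)
  show ?thesis
    by standard (auto simp: vf_scale_def fun_eq_iff scale_right_distrib scale_left_distrib)
qed

lemma commutator_vector_fields:
  assumes "D \<in> sl2_vector_fields" "E \<in> sl2_vector_fields"
  shows "commutator D E \<in> sl2_vector_fields"
proof -
  interpret vs: vector_space sl2_scale by (rule vector_space_sl2_scale)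
  interpret D: Vector_Spaces.linear sl2_scale sl2_scale D
    using assms by (simp add: sl2_vector_fields_def derivation_def)
  interpret E: Vector_Spaces.linear sl2_scale sl2_scale E
    using assms by (simp add: sl2_vector_fields_def derivation_def)
  have "Vector_Spaces.linear sl2_scale sl2_scale (commutator D E)"
    by standard
      (simp_all add: commutator_def D.add E.add D.scale E.scale vs.scale_right_diff_distrib)
  then show ?thesis
    using assms
    by (simp add: sl2_vector_fields_def derivation_def commutator_def D.add E.add algebra_simps)
qed


section \<open>Bracket width\<close>

text \<open>A Lie algebra is given here by its carrier \<open>L\<close> inside an ambient vector space with scalar
  multiplication \<open>s\<close>, together with its bracket \<open>br\<close>.\<close>

definition derived_algebra ::
  "('k::field \<Rightarrow> 'v::ab_group_add \<Rightarrow> 'v) \<Rightarrow> ('v \<Rightarrow> 'v \<Rightarrow> 'v) \<Rightarrow> 'v set \<Rightarrow> 'v set" where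
  "derived_algebra s br L = module.span s {br x y | x y. x \<in> L \<and> y \<in> L}"

text \<open>The value is \<open>\<infinity>\<close>, the infimum of the empty set, when \<open>z\<close> is not a sum of brackets.\<close>

definition bracket_length ::
  "('v \<Rightarrow> 'v \<Rightarrow> 'v) \<Rightarrow> 'v set \<Rightarrow> 'v::ab_group_add \<Rightarrow> enat" where
  "bracket_length br L z =
     Inf {enat m | m. \<exists>x y. (\<forall>i<m. x i \<in> L \<and> y i \<in> L) \<and> z = (\<Sum>i<m. br (x i) (y i))}"

definition bracket_width ::
  "('k::field \<Rightarrow> 'v::ab_group_add \<Rightarrow> 'v) \<Rightarrow> ('v \<Rightarrow> 'v \<Rightarrow> 'v) \<Rightarrow> 'v set \<Rightarrow> enat" where
  "bracket_width s br L = (SUP z \<in> derived_algebra s br L. bracket_length br L z)"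

end

(*
  The left-invariant fields e, h, f form a basis of the vector fields over the coordinate ring, and
  e', h', f' denote the right-invariant ones, which commute with e, h, f. Every vector field lies in
  im ad h + im ad h' + im ad (e + e'). The sum of the first two images contains all simultaneous
  eigenvectors of ad h and ad h' of nonzero weight. With t = x11 x22, the fields of weight (0,0)
  are spanned by H n = t^n h, E n = t^n x12 x22 e and F n = t^n x11 x21 f. If v has weight (-2,0),
  then [e',v] has nonzero weight, so [e,v] is congruent to [e + e', v]; this gives the relations
    (n+1) F n + H (n+1) = 0,   (n+2) H (n+1) - (n+1) H n - 2 E n = 0,
    (n+4) E (n+1) - (n+2) E n = 0,   H 0 = 0
  modulo the three images. They reduce everything to multiples of H 1, and
  h' = 2 H 1 - H 0 + 2 E 0 - 2 F 0 = -[e + e', f'] is congruent to 6 H 1, which kills H 1.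
*)

theory Submission
  imports Defs
begin

section \<open>Derivations of the coordinate ring\<close>

text \<open>The formal partial derivative. Exponents are subtracted with truncation at 0, but a
  monomial free of \<open>e\<close> also gets coefficient 0, so its wrong exponent does no
  harm.\<close>

definition partial :: "entry \<Rightarrow> 'k::comm_ring_1 entry_poly \<Rightarrow> 'k entry_poly" where
  "partial e p = (\<Sum>m\<in>Poly_Mapping.keys p.
     Poly_Mapping.single (m - Poly_Mapping.single e 1)
       (Poly_Mapping.lookup p m * of_nat (Poly_Mapping.lookup m e)))"

text \<open>Supports of \<open>p\<close>, \<open>q\<close> and \<open>p + q\<close> differ; over a
  common finite superset additivity becomes a termwise identity.\<close>

lemma partial_superset:
  assumes "finite S" "Poly_Mapping.keys p \<subseteq> S"
  shows "partial e p = (\<Sum>m\<in>S. Poly_Mapping.single (m - Poly_Mapping.single e 1)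
       (Poly_Mapping.lookup p m * of_nat (Poly_Mapping.lookup m e)))"
  unfolding partial_def using assms by (intro sum.mono_neutral_left) (auto simp: in_keys_iff)

lemma partial_0 [simp]: "partial e 0 = 0"
  by (simp add: partial_def)

lemma partial_add: "partial e (p + q) = partial e p + partial e q"
proof -
  have "finite (Poly_Mapping.keys p \<union> Poly_Mapping.keys q)"
    "Poly_Mapping.keys (p + q) \<subseteq> Poly_Mapping.keys p \<union> Poly_Mapping.keys q"
    using Poly_Mapping.keys_add[of p q] by simp_all
  then show ?thesis
    by (simp add: partial_superset[of "Poly_Mapping.keys p \<union> Poly_Mapping.keys q"]
        lookup_add sum.distrib distrib_right single_add)
qed

lemma partial_single:
  "partial e (Poly_Mapping.single m c) =
     Poly_Mapping.single (m - Poly_Mapping.single e 1) (c * of_nat (Poly_Mapping.lookup m e))"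
  using partial_superset[of "{m}" "Poly_Mapping.single m c"] by simp

text \<open>Truncated subtraction commutes with addition only where the lowered exponent is
  positive, hence the case distinction in the product rule for monomials.\<close>

lemma exponent_minus_add:
  fixes m n :: "entry \<Rightarrow>\<^sub>0 nat"
  assumes "Poly_Mapping.lookup m e \<noteq> 0"
  shows "m + n - Poly_Mapping.single e 1 = m - Poly_Mapping.single e 1 + n"
  using assms by (intro poly_mapping_eqI)
    (auto simp: lookup_add lookup_minus lookup_single when_def)

lemma partial_mult_single:
  "partial e (Poly_Mapping.single m c * Poly_Mapping.single n d) =
     partial e (Poly_Mapping.single m c) * Poly_Mapping.single n d +
     Poly_Mapping.single m c * partial e (Poly_Mapping.single n d)"
proof (cases "Poly_Mapping.lookup m e = 0 \<or> Poly_Mapping.lookup n e = 0")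
  case True
  then show ?thesis
    using exponent_minus_add[of m e n] exponent_minus_add[of n e m]
    by (cases "Poly_Mapping.lookup m e = 0"; cases "Poly_Mapping.lookup n e = 0")
      (auto simp: mult_single partial_single lookup_add ac_simps)
next
  case False
  then have "m - Poly_Mapping.single e 1 + n = m + n - Poly_Mapping.single e 1"
    "m + (n - Poly_Mapping.single e 1) = m + n - Poly_Mapping.single e 1"
    using exponent_minus_add[of m e n] exponent_minus_add[of n e m] by (simp_all add: add.commute)
  then show ?thesis
    by (simp add: mult_single partial_single lookup_add single_add[symmetric] algebra_simps)
qed

lemma partial_mult: "partial e (p * q) = partial e p * q + p * partial e q"
proof (induction q rule: entry_poly_induct)
  case (2 q n d)
  have "partial e (p * Poly_Mapping.single n d) =
      partial e p * Poly_Mapping.single n d + p * partial e (Poly_Mapping.single n d)"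
    by (induction p rule: entry_poly_induct)
      (simp_all add: partial_add partial_mult_single algebra_simps)
  with 2 show ?case by (simp add: partial_add algebra_simps)
qed simp

lemma partial_const_poly [simp]: "partial e (const_poly c) = 0"
  by (simp add: const_poly_def partial_single)

lemma partial_minus: "partial e (p - q) = partial e p - partial e q"
  using partial_add[of e "p - q" q] by simp

lemma partial_var: "partial e (var e') = (if e = e' then 1 else 0)"
  by (simp add: var_def partial_single lookup_single)

section \<open>Coordinate functions and derivations with prescribed values on them\<close>

lift_definition coord :: "entry \<Rightarrow> 'k::comm_ring_1 sl2_ring" is var .

abbreviation x11 :: "'k::comm_ring_1 sl2_ring" where "x11 \<equiv> coord A11"
abbreviation x12 :: "'k::comm_ring_1 sl2_ring" where "x12 \<equiv> coord A12"
abbreviation x21 :: "'k::comm_ring_1 sl2_ring" where "x21 \<equiv> coord A21"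
abbreviation x22 :: "'k::comm_ring_1 sl2_ring" where "x22 \<equiv> coord A22"

lemma det_eq_1: "x11 * x22 - x12 * x21 = (1 :: 'k::comm_ring_1 sl2_ring)"
  by transfer (simp add: sl2_relation_def)

lemma abs_sl2_relation [simp]: "abs_sl2_ring sl2_relation = 0"
  by (simp add: zero_sl2_ring_def sl2_ring.abs_eq_iff)

lemma abs_rep_sl2_ring: "abs_sl2_ring (rep_sl2_ring f) = f"
  using Quotient_sl2_ring by (rule Quotient_abs_rep)

lemma sl2_scale_eq: "sl2_scale c f = sl2_scale c 1 * f"
  by transfer simp

text \<open>The derivation along the quotient map, from polynomials to the coordinate ring, with
  value \<open>v e\<close> at \<open>var e\<close>.\<close>

definition poly_der :: "(entry \<Rightarrow> 'k sl2_ring) \<Rightarrow> 'k::comm_ring_1 entry_poly \<Rightarrow> 'k sl2_ring" where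
  "poly_der v p = (\<Sum>e\<in>{A11, A12, A21, A22}. abs_sl2_ring (partial e p) * v e)"

lemma poly_der_add: "poly_der v (p + q) = poly_der v p + poly_der v q"
  by (simp add: poly_der_def partial_add plus_sl2_ring.abs_eq[symmetric] algebra_simps)

lemma poly_der_minus: "poly_der v (p - q) = poly_der v p - poly_der v q"
  by (simp add: poly_der_def partial_minus minus_sl2_ring.abs_eq[symmetric] algebra_simps)

lemma poly_der_mult:
  "poly_der v (p * q) = poly_der v p * abs_sl2_ring q + abs_sl2_ring p * poly_der v q"
  by (simp add: poly_der_def partial_mult plus_sl2_ring.abs_eq[symmetric]
      times_sl2_ring.abs_eq[symmetric] algebra_simps)

lemma poly_der_const_poly: "poly_der v (const_poly c) = 0"
  by (simp add: poly_der_def zero_sl2_ring_def[symmetric])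

lemma poly_der_var: "poly_der v (var e) = v e"
  by (cases e) (simp_all add: poly_der_def partial_var zero_sl2_ring_def[symmetric]
      one_sl2_ring_def[symmetric])

text \<open>The linearised equation det = 1 in the direction of the matrix \<open>v\<close>.\<close>

definition tangent :: "(entry \<Rightarrow> 'k::comm_ring_1 sl2_ring) \<Rightarrow> bool" where
  "tangent v \<longleftrightarrow> v A11 * x22 + x11 * v A22 - v A12 * x21 - x12 * v A21 = 0"

text \<open>Computed on a chosen representative; under \<open>tangent v\<close> the choice does not
  matter, by \<open>field_of_abs\<close>.\<close>

definition field_of :: "(entry \<Rightarrow> 'k sl2_ring) \<Rightarrow> 'k::comm_ring_1 sl2_ring \<Rightarrow> 'k sl2_ring" where
  "field_of v f = poly_der v (rep_sl2_ring f)"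

lemma poly_der_relation: "tangent v \<Longrightarrow> poly_der v sl2_relation = 0"
  using poly_der_const_poly[of v 1]
  by (simp add: sl2_relation_def poly_der_minus poly_der_mult poly_der_var tangent_def
      coord.abs_eq[symmetric] const_poly_simps poly_der_add algebra_simps)

text \<open>Representatives differ by some \<open>sl2_relation * q\<close>. The product rule gives
  two terms: one contains \<open>poly_der v sl2_relation\<close>, zero by tangency, the other the
  class of \<open>sl2_relation\<close>, zero in the quotient.\<close>

lemma field_of_abs:
  assumes "tangent v"
  shows "field_of v (abs_sl2_ring p) = poly_der v p"
proof -
  have "sl2_relation dvd rep_sl2_ring (abs_sl2_ring p) - p"
    by (simp add: sl2_ring.abs_eq_iff[symmetric] abs_rep_sl2_ring)
  then obtain q where "rep_sl2_ring (abs_sl2_ring p) = p + sl2_relation * q"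
    by (metis dvdE diff_add_cancel add.commute)
  then show ?thesis
    using poly_der_relation[OF assms] by (simp add: field_of_def poly_der_add poly_der_mult)
qed

lemma field_of_coord: "tangent v \<Longrightarrow> field_of v (coord e) = v e"
  by (simp add: coord.abs_eq field_of_abs poly_der_var)

text \<open>Scaling by \<open>c\<close> is multiplication by the constant
  \<open>sl2_scale c 1\<close>, so the Leibniz rule and vanishing on constants give homogeneity.
  Conversely, a linear derivation kills 1 and hence all constants.\<close>

lemma derivation_iff:
  "derivation (D :: 'k::field sl2_ring \<Rightarrow> _) \<longleftrightarrow>
    (\<forall>f g. D (f + g) = D f + D g) \<and> (\<forall>f g. D (f * g) = D f * g + f * D g) \<and>
    (\<forall>c. D (sl2_scale c 1) = 0)"
proof -
  interpret vs: vector_space "sl2_scale :: 'k \<Rightarrow> _" by (rule vector_space_sl2_scale)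
  show ?thesis
  proof
    assume D: "derivation D"
    then interpret D: Vector_Spaces.linear sl2_scale sl2_scale D by (simp add: derivation_def)
    have "D (1 * 1) = D 1 * 1 + 1 * D 1" using D unfolding derivation_def by blast
    then have "D 1 = 0" by simp
    then show "(\<forall>f g. D (f + g) = D f + D g) \<and> (\<forall>f g. D (f * g) = D f * g + f * D g) \<and>
        (\<forall>c. D (sl2_scale c 1) = 0)"
      using D by (auto simp: D.add D.scale derivation_def)
  next
    assume D: "(\<forall>f g. D (f + g) = D f + D g) \<and> (\<forall>f g. D (f * g) = D f * g + f * D g) \<and>
        (\<forall>c. D (sl2_scale c 1) = 0)"
    then have "D (sl2_scale c f) = sl2_scale c (D f)" for c f
      by (metis sl2_scale_eq mult_zero_left add_0)
    with D show "derivation D"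
      unfolding derivation_def by (auto intro!: Vector_Spaces.linear.intro vector_space_sl2_scale
          simp: module_hom_axioms_def module_hom_def vs.module_axioms linear_def)
  qed
qed

lemma derivation_field_of:
  assumes "tangent v"
  shows "derivation (field_of v)"
  unfolding derivation_iff
proof (intro conjI allI)
  fix f g :: "'a sl2_ring" and c :: 'a
  show "field_of v (f + g) = field_of v f + field_of v g"
    by (metis assms abs_rep_sl2_ring field_of_abs poly_der_add plus_sl2_ring.abs_eq)
  show "field_of v (f * g) = field_of v f * g + f * field_of v g"
    by (metis assms abs_rep_sl2_ring field_of_abs poly_der_mult times_sl2_ring.abs_eq)
  show "field_of v (sl2_scale c 1) = 0"
    by (simp add: one_sl2_ring_def sl2_scale.abs_eq field_of_abs[OF assms] poly_der_const_poly)
qed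

section \<open>Monomials as a linear spanning set\<close>

lemma single_exponent:
  "Poly_Mapping.single m c = const_poly c * var A11 ^ Poly_Mapping.lookup m A11 *
     var A12 ^ Poly_Mapping.lookup m A12 * var A21 ^ Poly_Mapping.lookup m A21 *
     var A22 ^ Poly_Mapping.lookup m A22" (is "_ = ?r")
proof -
  have var_power: "var e ^ n = Poly_Mapping.single (Poly_Mapping.single e n) (1 :: 'a)" for e n
    by (induction n) (simp_all add: var_def mult_single single_add[symmetric])
  have "m = Poly_Mapping.single A11 (Poly_Mapping.lookup m A11) +
      Poly_Mapping.single A12 (Poly_Mapping.lookup m A12) +
      Poly_Mapping.single A21 (Poly_Mapping.lookup m A21) +
      Poly_Mapping.single A22 (Poly_Mapping.lookup m A22)" (is "_ = ?m")
  proof (rule poly_mapping_eqI)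
    show "Poly_Mapping.lookup m e = Poly_Mapping.lookup ?m e" for e
      by (cases e) (simp_all add: lookup_add lookup_single)
  qed
  moreover have "?r = Poly_Mapping.single ?m c"
    by (simp only: var_power const_poly_def mult_single mult_1_right add_0_left)
  ultimately show ?thesis by simp
qed

definition coord_mono :: "nat \<Rightarrow> nat \<Rightarrow> nat \<Rightarrow> nat \<Rightarrow> 'k::comm_ring_1 sl2_ring" where
  "coord_mono i j k l = x11 ^ i * x12 ^ j * x21 ^ k * x22 ^ l"

lemma abs_sl2_ring_power: "abs_sl2_ring p ^ n = abs_sl2_ring (p ^ n)"
  by (induction n) (simp_all add: one_sl2_ring_def times_sl2_ring.abs_eq)

lemma sl2_ring_induct [case_names zero add]:
  fixes f :: "'k::comm_ring_1 sl2_ring"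
  assumes "P 0" and "\<And>f c i j k l. P f \<Longrightarrow> P (f + sl2_scale c (coord_mono i j k l))"
  shows "P f"
proof -
  have "P (abs_sl2_ring p)" for p
  proof (induction p rule: entry_poly_induct)
    case 1
    then show ?case using assms(1) by (simp add: zero_sl2_ring_def)
  next
    case (2 p m c)
    have "abs_sl2_ring (Poly_Mapping.single m c) = sl2_scale c (coord_mono (Poly_Mapping.lookup m A11)
        (Poly_Mapping.lookup m A12) (Poly_Mapping.lookup m A21) (Poly_Mapping.lookup m A22))"
      by (subst single_exponent) (simp add: coord_mono_def coord.abs_eq abs_sl2_ring_power
          times_sl2_ring.abs_eq sl2_scale.abs_eq mult.assoc)
    with assms(2) 2 show ?case by (metis plus_sl2_ring.abs_eq)
  qed
  from this[of "rep_sl2_ring f"] show ?thesis by (simp add: abs_rep_sl2_ring)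
qed

section \<open>Vector fields and their weights\<close>

lemma vector_fieldD:
  assumes "D \<in> (sl2_vector_fields :: ('k::field sl2_ring \<Rightarrow> _) set)"
  shows vector_field_add: "D (f + g) = D f + D g"
    and vector_field_mult: "D (f * g) = D f * g + f * D g"
    and vector_field_const: "D (sl2_scale c 1) = 0"
  using assms by (simp_all add: sl2_vector_fields_def derivation_iff)

lemma sl2_scale_of_int: "sl2_scale (of_int n) 1 = (of_int n :: 'k::field sl2_ring)"
proof -
  interpret vs: vector_space "sl2_scale :: 'k \<Rightarrow> _" by (rule vector_space_sl2_scale)
  have nat: "sl2_scale (of_nat n) 1 = (of_nat n :: 'k sl2_ring)" for n
    by (induction n) (simp_all add: vs.scale_left_distrib)
  show ?thesis by (cases n) (simp_all add: nat vs.scale_left_diff_distrib)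
qed

text \<open>Integer scalars become ring factors, so that eigenvalue equations can be checked by ring
  arithmetic.\<close>

lemma vf_scale_of_int: "vf_scale (of_int n) D = (\<lambda>x. of_int n * D x)"
  unfolding vf_scale_def by (subst sl2_scale_eq) (simp add: sl2_scale_of_int)

lemma vf_scale_of_nat: "vf_scale (of_nat n) D = (\<lambda>x. of_nat n * D x)"
  using vf_scale_of_int[of "int n" D] by simp

context
  fixes D :: "'k::field sl2_ring \<Rightarrow> 'k sl2_ring"
  assumes D: "D \<in> sl2_vector_fields"
begin

lemma vector_field_0: "D 0 = 0"
  using vector_field_add[OF D, of 0 0] by simp

lemma vector_field_1: "D 1 = 0"
  using vector_field_mult[OF D, of 1 1] by simp

lemma vector_field_minus: "D (f - g) = D f - D g"
  using vector_field_add[OF D, of "f - g" g] by simp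

lemma vector_field_uminus: "D (- f) = - D f"
  using vector_field_minus[of 0 f] by (simp add: vector_field_0)

lemma vector_field_scale: "D (sl2_scale c f) = sl2_scale c (D f)"
  by (metis D sl2_scale_eq vector_field_mult vector_field_const mult_zero_left add_0)

lemma vector_field_of_int_mult: "D (of_int n * f) = of_int n * D f"
  using vector_field_scale[of "of_int n" f]
  by (metis sl2_scale_eq sl2_scale_of_int)

lemma vector_field_power: "D (f ^ n) = of_nat n * f ^ (n - 1) * D f"
proof (induction n)
  case (Suc n)
  then show ?case
    by (cases n) (simp_all add: vector_field_mult[OF D] algebra_simps)
qed (simp add: vector_field_1)

end

lemmas vector_field_simps = vector_field_0 vector_field_1 vector_field_add vector_field_minus
  vector_field_uminus vector_field_mult

text \<open>A derivation is determined on generators: the product and power rules fix it on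
  monomials, linearity on their span.\<close>

lemma vector_field_eqI:
  assumes D: "D \<in> sl2_vector_fields" and E: "E \<in> sl2_vector_fields"
    and eq: "D x11 = E x11" "D x12 = E x12" "D x21 = E x21" "D x22 = E x22"
  shows "D = E"
proof
  fix f
  show "D f = E f"
  proof (induction f rule: sl2_ring_induct)
    case zero
    show ?case using D E by (simp add: vector_field_0)
  next
    case (add f c i j k l)
    have "D (coord_mono i j k l) = E (coord_mono i j k l)"
      using D E eq by (simp add: coord_mono_def vector_field_mult vector_field_power)
    with add show ?case using D E by (simp add: vector_field_add vector_field_scale)
  qed
qed

section \<open>Vector fields as a module over the coordinate ring\<close>

definition mult_field ::
  "'k::comm_ring_1 sl2_ring \<Rightarrow> ('k sl2_ring \<Rightarrow> 'k sl2_ring) \<Rightarrow> 'k sl2_ring \<Rightarrow> 'k sl2_ring"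
  (infixr "\<odot>" 75) where
  "g \<odot> D = (\<lambda>x. g * D x)"

lemma mult_field_mult: "(f * g) \<odot> D = f \<odot> g \<odot> D"
  by (simp add: mult_field_def mult.assoc)

lemma mult_field_add_left: "(f + g) \<odot> D = f \<odot> D + g \<odot> D"
  by (simp add: mult_field_def fun_eq_iff distrib_right)

lemma mult_field_diff_left: "(f - g) \<odot> D = f \<odot> D - g \<odot> D"
  by (simp add: mult_field_def fun_eq_iff left_diff_distrib)

lemma mult_field_1 [simp]: "1 \<odot> D = D"
  by (simp add: mult_field_def)

lemma vf_scale_mult_field: "sl2_scale c g \<odot> D = vf_scale c (g \<odot> D)"
proof
  fix x
  show "(sl2_scale c g \<odot> D) x = vf_scale c (g \<odot> D) x"
    unfolding mult_field_def vf_scale_def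
    by (subst sl2_scale_eq, subst (2) sl2_scale_eq) (simp add: mult.assoc)
qed

lemma mult_field_vector_field:
  "D \<in> sl2_vector_fields \<Longrightarrow> g \<odot> D \<in> sl2_vector_fields"
  by (auto simp: sl2_vector_fields_def derivation_iff mult_field_def algebra_simps)

lemma vf_scale_vector_field:
  assumes "D \<in> sl2_vector_fields"
  shows "vf_scale c D \<in> sl2_vector_fields"
  using mult_field_vector_field[OF assms, of "sl2_scale c 1"] by (simp add: vf_scale_mult_field)

lemma add_vector_field:
  "D \<in> sl2_vector_fields \<Longrightarrow> E \<in> sl2_vector_fields \<Longrightarrow> D + E \<in> sl2_vector_fields"
  by (auto simp: sl2_vector_fields_def derivation_iff algebra_simps)

lemma zero_vector_field: "0 \<in> sl2_vector_fields"
  by (auto simp: sl2_vector_fields_def derivation_iff)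

lemma commutator_mult_field:
  assumes "D \<in> sl2_vector_fields"
  shows "commutator D (g \<odot> E) = D g \<odot> E + g \<odot> commutator D E"
  using assms by (simp add: fun_eq_iff commutator_def mult_field_def vector_field_mult algebra_simps)

section \<open>Left- and right-invariant vector fields\<close>

definition left_e :: "'k::comm_ring_1 sl2_ring \<Rightarrow> 'k sl2_ring" where
  "left_e = field_of (case_entry 0 x11 0 x21)"
definition left_h :: "'k::comm_ring_1 sl2_ring \<Rightarrow> 'k sl2_ring" where
  "left_h = field_of (case_entry x11 (- x12) x21 (- x22))"
definition left_f :: "'k::comm_ring_1 sl2_ring \<Rightarrow> 'k sl2_ring" where
  "left_f = field_of (case_entry x12 0 x22 0)"
definition right_e :: "'k::comm_ring_1 sl2_ring \<Rightarrow> 'k sl2_ring" where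
  "right_e = field_of (case_entry x21 x22 0 0)"
definition right_h :: "'k::comm_ring_1 sl2_ring \<Rightarrow> 'k sl2_ring" where
  "right_h = field_of (case_entry x11 x12 (- x21) (- x22))"
definition right_f :: "'k::comm_ring_1 sl2_ring \<Rightarrow> 'k sl2_ring" where
  "right_f = field_of (case_entry 0 0 x11 x12)"

lemmas invariant_field_defs =
  left_e_def left_h_def left_f_def right_e_def right_h_def right_f_def

text \<open>Let X be the coordinate matrix and A one of the standard matrices e, h, f of sl2. The
  left fields send X to X A, the right ones to A X. In both cases the tangency expression is det X
  times the trace of A, which is 0.\<close>

lemma invariant_fields [simp]:
  "left_e \<in> sl2_vector_fields" "left_h \<in> sl2_vector_fields" "left_f \<in> sl2_vector_fields"
  "right_e \<in> sl2_vector_fields" "right_h \<in> sl2_vector_fields" "right_f \<in> sl2_vector_fields"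
  by (simp_all add: sl2_vector_fields_def invariant_field_defs derivation_field_of tangent_def
      algebra_simps)

lemma invariant_field_coord [simp]:
  "left_e x11 = 0" "left_e x12 = x11" "left_e x21 = 0" "left_e x22 = x21"
  "left_h x11 = x11" "left_h x12 = - x12" "left_h x21 = x21" "left_h x22 = - x22"
  "left_f x11 = x12" "left_f x12 = 0" "left_f x21 = x22" "left_f x22 = 0"
  "right_e x11 = x21" "right_e x12 = x22" "right_e x21 = 0" "right_e x22 = 0"
  "right_h x11 = x11" "right_h x12 = x12" "right_h x21 = - x21" "right_h x22 = - x22"
  "right_f x11 = 0" "right_f x12 = 0" "right_f x21 = x11" "right_f x22 = x12"
  by (simp_all add: invariant_field_defs field_of_coord tangent_def algebra_simps)

text \<open>The coefficients are the entries (1,2), (1,1) and (2,1) of X^{-1} D(X), where X^{-1} is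
  the adjugate because det X = 1. Tangency of \<open>D\<close> makes this matrix traceless, so three
  entries suffice.\<close>

lemma vector_field_decomposition:
  assumes D: "D \<in> sl2_vector_fields"
  shows "D = (x22 * D x12 - x12 * D x22) \<odot> left_e + (x22 * D x11 - x12 * D x21) \<odot> left_h +
    (x11 * D x21 - x21 * D x11) \<odot> left_f" (is "D = ?E")
proof (rule vector_field_eqI[OF D])
  show "?E \<in> sl2_vector_fields"
    by (intro add_vector_field mult_field_vector_field invariant_fields)
  have det: "x11 * x22 = 1 + x12 * (x21 :: 'a sl2_ring)"
    using det_eq_1 by (simp add: algebra_simps)
  have "D (x11 * x22) = D (1 + x12 * x21)" by (simp add: det)
  then have tangent: "x22 * D x11 + x11 * D x22 = x21 * D x12 + x12 * D x21"
    by (simp add: vector_field_simps[OF D] algebra_simps)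
  \<comment> \<open>The first column of X needs only det = 1. In the second, entry (2,2) is replaced
    by minus entry (1,1), at the cost of a multiple of the tangency equation.\<close>
  have "?E x11 = D x11 * (x11 * x22 - x12 * x21)" "?E x21 = D x21 * (x11 * x22 - x12 * x21)"
    "?E x12 = D x12 * (x11 * x22 - x12 * x21) -
      x12 * ((x22 * D x11 + x11 * D x22) - (x21 * D x12 + x12 * D x21))"
    "?E x22 = D x22 * (x11 * x22 - x12 * x21) -
      x22 * ((x22 * D x11 + x11 * D x22) - (x21 * D x12 + x12 * D x21)) +
      D x22 * 0"
    by (simp_all add: mult_field_def algebra_simps)
  then show "D x11 = ?E x11" "D x12 = ?E x12" "D x21 = ?E x21" "D x22 = ?E x22"
    by (simp_all add: det_eq_1 tangent)
qed

lemma commutator_eqI: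
  assumes "D \<in> sl2_vector_fields" "E \<in> sl2_vector_fields" "F \<in> sl2_vector_fields"
    and "D (E x11) - E (D x11) = F x11" "D (E x12) - E (D x12) = F x12"
    and "D (E x21) - E (D x21) = F x21" "D (E x22) - E (D x22) = F x22"
  shows "commutator D E = F"
  using assms by (intro vector_field_eqI commutator_vector_fields) (simp_all add: commutator_def)

lemma vf_scale_numeral:
  "vf_scale (numeral n) D x = numeral n * D x" "vf_scale (- numeral n) D x = - numeral n * D x"
  "vf_scale 0 D x = 0" "vf_scale 1 D x = D x" "vf_scale (- 1) D x = - D x"
  using vf_scale_of_int[of "numeral n" D] vf_scale_of_int[of "- numeral n" D]
    vf_scale_of_int[of 0 D] vf_scale_of_int[of 1 D] vf_scale_of_int[of "- 1" D]
  by simp_all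

lemma left_brackets:
  "commutator left_e left_e = (0 :: 'k::field sl2_ring \<Rightarrow> _)"
  "commutator left_e left_f = (left_h :: 'k::field sl2_ring \<Rightarrow> _)"
  "commutator left_e left_h = vf_scale (- 2) left_e"
  subgoal by (rule commutator_eqI) (simp_all add: zero_vector_field vector_field_0)
  subgoal by (rule commutator_eqI) (simp_all add: vector_field_0)
  subgoal by (rule commutator_eqI)
    (simp_all add: vf_scale_vector_field vector_field_uminus vector_field_0 vf_scale_numeral)
  done

text \<open>Left and right multiplications of X commute. Composing left multiplications reverses the
  order of the matrices, hence the minus sign.\<close>

lemma right_brackets:
  "commutator left_e right_f = (0 :: 'k::field sl2_ring \<Rightarrow> _)"
  "commutator right_e right_f = vf_scale (- 1) right_h"
  subgoal by (rule commutator_eqI) (simp_all add: zero_vector_field vector_field_0)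
  subgoal by (rule commutator_eqI)
    (simp_all add: vf_scale_vector_field vector_field_0 vf_scale_numeral)
  done

section \<open>Simultaneous eigenvectors of ad h and ad h'\<close>

definition weight :: "int \<Rightarrow> int \<Rightarrow> ('k::field sl2_ring \<Rightarrow> 'k sl2_ring) \<Rightarrow> bool" where
  "weight i j D \<longleftrightarrow> D \<in> sl2_vector_fields \<and>
     commutator left_h D = vf_scale (of_int i) D \<and> commutator right_h D = vf_scale (of_int j) D"

lemma weight_iff:
  "weight i j D \<longleftrightarrow> D \<in> sl2_vector_fields \<and>
     (\<forall>x. left_h (D x) = D (left_h x) + of_int i * D x) \<and>
     (\<forall>x. right_h (D x) = D (right_h x) + of_int j * D x)"
  unfolding weight_def vf_scale_of_int commutator_def fun_eq_iff
  by (simp add: diff_eq_eq add.commute)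

text \<open>The weight of \<open>right_e\<close> is -2 and not 2 because right-invariant fields
  satisfy the sl2 relations with reversed sign.\<close>

lemma weight_invariant_fields:
  "weight 2 0 left_e" "weight 0 0 left_h" "weight (- 2) 0 left_f" "weight 0 (- 2) right_e"
  unfolding weight_def
  by - (intro conjI commutator_eqI; simp add: vf_scale_vector_field vector_field_uminus
    vector_field_0 vf_scale_numeral)+

lemma vector_field_eigen_power:
  assumes "D \<in> sl2_vector_fields" "D f = of_int s * f"
  shows "D (f ^ n) = of_int (int n * s) * f ^ n"
  using assms by (induction n) (simp_all add: vector_field_1 vector_field_mult algebra_simps)

lemma left_h_coord_mono:
  "left_h (coord_mono i j k l) =
     of_int (int i - int j + int k - int l) * (coord_mono i j k l :: 'k::field sl2_ring)"
  using vector_field_eigen_power[of left_h "x11 :: 'k sl2_ring" 1 i]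
    vector_field_eigen_power[of left_h "x12 :: 'k sl2_ring" "-1" j]
    vector_field_eigen_power[of left_h "x21 :: 'k sl2_ring" 1 k]
    vector_field_eigen_power[of left_h "x22 :: 'k sl2_ring" "-1" l]
  by (simp add: coord_mono_def vector_field_mult algebra_simps)

lemma right_h_coord_mono:
  "right_h (coord_mono i j k l) =
     of_int (int i + int j - int k - int l) * (coord_mono i j k l :: 'k::field sl2_ring)"
  using vector_field_eigen_power[of right_h "x11 :: 'k sl2_ring" 1 i]
    vector_field_eigen_power[of right_h "x12 :: 'k sl2_ring" 1 j]
    vector_field_eigen_power[of right_h "x21 :: 'k sl2_ring" "-1" k]
    vector_field_eigen_power[of right_h "x22 :: 'k sl2_ring" "-1" l]
  by (simp add: coord_mono_def vector_field_mult algebra_simps)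

text \<open>By the Leibniz rule weights add; \<open>x11\<close>, \<open>x12\<close>,
  \<open>x21\<close>, \<open>x22\<close> have weights (1,1), (-1,1), (1,-1), (-1,-1).\<close>

lemma weight_coord_mono:
  assumes "weight a b D"
  shows "weight (int i - int j + int k - int l + a) (int i + int j - int k - int l + b)
    (coord_mono i j k l \<odot> D)"
  using assms unfolding weight_iff
  by (auto simp: mult_field_vector_field)
    (simp_all add: mult_field_def vector_field_mult left_h_coord_mono right_h_coord_mono
      algebra_simps)

text \<open>By the Jacobi identity ad h and ad h' act as derivations of the bracket, so eigenvalues
  add.\<close>

lemma weight_commutator:
  assumes "weight a b D" "weight c d E"
  shows "weight (a + c) (b + d) (commutator D E)"
  using assms unfolding weight_iff
  by (auto simp: commutator_vector_fields)
    (simp_all add: commutator_def vector_field_minus vector_field_add vector_field_of_int_mult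
      distrib_right right_diff_distrib)

section \<open>The sum of three adjoint images\<close>

text \<open>The sum of the images of ad h, ad h' and ad (e + e'). Membership exhibits a sum of three
  brackets, which is the bound sought.\<close>

definition bracket_span :: "('k::field sl2_ring \<Rightarrow> 'k sl2_ring) set" where
  "bracket_span = {commutator left_h x + commutator right_h y + commutator (left_e + right_e) z | x y z.
     x \<in> sl2_vector_fields \<and> y \<in> sl2_vector_fields \<and> z \<in> sl2_vector_fields}"

lemma commutator_add_right:
  "D \<in> sl2_vector_fields \<Longrightarrow> commutator D (E + F) = commutator D E + commutator D F"
  by (simp add: commutator_def fun_eq_iff vector_field_add)

lemma commutator_add_left:
  "F \<in> sl2_vector_fields \<Longrightarrow> commutator (D + E) F = commutator D F + commutator E F"
  by (simp add: commutator_def fun_eq_iff vector_field_add)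

lemma commutator_0_right: "D \<in> sl2_vector_fields \<Longrightarrow> commutator D 0 = 0"
  by (simp add: commutator_def fun_eq_iff vector_field_0)

lemma commutator_vf_scale_right:
  assumes "D \<in> sl2_vector_fields"
  shows "commutator D (vf_scale c E) = vf_scale c (commutator D E)"
proof -
  interpret vector_space "sl2_scale :: 'a \<Rightarrow> _" by (rule vector_space_sl2_scale)
  show ?thesis
    using assms
    by (simp add: commutator_def vf_scale_def fun_eq_iff vector_field_scale scale_right_diff_distrib)
qed

interpretation vf: vector_space "vf_scale :: 'k::field \<Rightarrow> _"
  by (rule vector_space_vf_scale)

lemma subspace_vector_fields: "vf.subspace sl2_vector_fields"
  by (simp add: vf.subspace_def zero_vector_field add_vector_field vf_scale_vector_field)

lemma bracket_spanI:
  assumes "x \<in> sl2_vector_fields" "y \<in> sl2_vector_fields" "z \<in> sl2_vector_fields"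
  shows "commutator left_h x + commutator right_h y + commutator (left_e + right_e) z
    \<in> bracket_span"
  using assms unfolding bracket_span_def by blast

text \<open>The left entries of the three brackets are fixed and a bracket is linear in its right
  entry, so linear combinations still take three brackets.\<close>

lemma subspace_bracket_span: "vf.subspace bracket_span"
proof (rule vf.subspaceI)
  show "0 \<in> bracket_span"
    using bracket_spanI[OF zero_vector_field zero_vector_field zero_vector_field]
    by (simp add: commutator_0_right add_vector_field)
next
  fix D E :: "'a sl2_ring \<Rightarrow> 'a sl2_ring"
  assume "D \<in> bracket_span" "E \<in> bracket_span"
  then obtain x y z x' y' z' where
    "D = commutator left_h x + commutator right_h y + commutator (left_e + right_e) z"
    "E = commutator left_h x' + commutator right_h y' + commutator (left_e + right_e) z'"
    "x \<in> sl2_vector_fields" "y \<in> sl2_vector_fields" "z \<in> sl2_vector_fields"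
    "x' \<in> sl2_vector_fields" "y' \<in> sl2_vector_fields" "z' \<in> sl2_vector_fields"
    unfolding bracket_span_def by blast
  then show "D + E \<in> bracket_span"
    using bracket_spanI[of "x + x'" "y + y'" "z + z'"]
    by (simp add: commutator_add_right add_vector_field algebra_simps)
next
  fix c and D :: "'a sl2_ring \<Rightarrow> 'a sl2_ring"
  assume "D \<in> bracket_span"
  then obtain x y z where
    "D = commutator left_h x + commutator right_h y + commutator (left_e + right_e) z"
    "x \<in> sl2_vector_fields" "y \<in> sl2_vector_fields" "z \<in> sl2_vector_fields"
    unfolding bracket_span_def by blast
  then show "vf_scale c D \<in> bracket_span"
    using bracket_spanI[of "vf_scale c x" "vf_scale c y" "vf_scale c z"]
    by (simp add: commutator_vf_scale_right vf_scale_vector_field add_vector_field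
        vf.scale_right_distrib)
qed

text \<open>Solves a relation modulo \<open>bracket_span\<close> for a term with invertible
  coefficient.\<close>

lemma bracket_span_cancel:
  assumes "c \<noteq> 0" "vf_scale c D + E \<in> bracket_span" "E \<in> bracket_span"
  shows "D \<in> bracket_span"
proof -
  have "vf_scale c D \<in> bracket_span"
    using vf.subspace_diff[OF subspace_bracket_span assms(2,3)] by simp
  then have "vf_scale (inverse c) (vf_scale c D) \<in> bracket_span"
    by (rule vf.subspace_scale[OF subspace_bracket_span])
  with assms(1) show ?thesis by simp
qed

lemma commutator_mem_bracket_span:
  assumes "D \<in> sl2_vector_fields"
  shows "commutator left_h D \<in> bracket_span" "commutator right_h D \<in> bracket_span"
    "commutator (left_e + right_e) D \<in> bracket_span"
  using bracket_spanI[OF assms zero_vector_field zero_vector_field]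
    bracket_spanI[OF zero_vector_field assms zero_vector_field]
    bracket_spanI[OF zero_vector_field zero_vector_field assms]
  by (simp_all add: commutator_0_right add_vector_field)

text \<open>An eigenvector with invertible eigenvalue lies in the image; nonzero integers are
  invertible in characteristic 0.\<close>

lemma weight_nonzero_mem:
  fixes D :: "'k::field_char_0 sl2_ring \<Rightarrow> 'k sl2_ring"
  assumes "weight i j D" "i \<noteq> 0 \<or> j \<noteq> 0"
  shows "D \<in> bracket_span"
proof -
  have "vf_scale (of_int i) D \<in> bracket_span" "vf_scale (of_int j) D \<in> bracket_span"
    using assms(1) commutator_mem_bracket_span[of D] unfolding weight_def by auto
  then show ?thesis
    using assms(2) bracket_span_cancel[of "of_int i" D 0] bracket_span_cancel[of "of_int j" D 0]
      vf.subspace_0[OF subspace_bracket_span] by auto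
qed

text \<open>Source of the recurrences below: here \<open>commutator left_e D\<close> has weight
  (0,0), out of reach of \<open>weight_nonzero_mem\<close>, whereas
  \<open>commutator right_e D\<close> has weight (-2,-2).\<close>

lemma commutator_left_e_mem:
  fixes D :: "'k::field_char_0 sl2_ring \<Rightarrow> 'k sl2_ring"
  assumes "weight (- 2) 0 D"
  shows "commutator left_e D \<in> bracket_span"
proof -
  have D: "D \<in> sl2_vector_fields" using assms by (simp add: weight_def)
  have "weight (- 2) (- 2) (commutator right_e D)"
    using weight_commutator[OF weight_invariant_fields(4) assms] by simp
  then have "commutator right_e D \<in> bracket_span" by (rule weight_nonzero_mem) simp
  moreover have "commutator left_e D + commutator right_e D \<in> bracket_span"
    using commutator_mem_bracket_span(3)[OF D] by (simp add: commutator_add_left[OF D])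
  ultimately show ?thesis
    using vf.subspace_diff[OF subspace_bracket_span] by fastforce
qed

text \<open>\<open>right_f\<close> commutes with \<open>left_e\<close>, so only its bracket with
  \<open>right_e\<close> survives.\<close>

lemma right_h_mem: "(right_h :: 'k::field_char_0 sl2_ring \<Rightarrow> _) \<in> bracket_span"
proof (rule bracket_span_cancel)
  show "vf_scale (- 1) right_h + 0 \<in> bracket_span"
    using commutator_mem_bracket_span(3)[of right_f]
    by (simp add: commutator_add_left right_brackets)
qed (simp_all add: vf.subspace_0[OF subspace_bracket_span])

section \<open>Relations among the fields of weight (0,0)\<close>

definition tH :: "nat \<Rightarrow> 'k::field sl2_ring \<Rightarrow> 'k sl2_ring" where
  "tH n = (x11 * x22) ^ n \<odot> left_h"
text \<open>The factor \<open>x12 * x22\<close> of weight (-2,0) offsets the weight of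
  \<open>left_e\<close>; in \<open>tF\<close> the factor \<open>x11 * x21\<close> of weight (2,0)
  does so for \<open>left_f\<close>.\<close>

definition tE :: "nat \<Rightarrow> 'k::field sl2_ring \<Rightarrow> 'k sl2_ring" where
  "tE n = ((x11 * x22) ^ n * (x12 * x22)) \<odot> left_e"
definition tF :: "nat \<Rightarrow> 'k::field sl2_ring \<Rightarrow> 'k sl2_ring" where
  "tF n = ((x11 * x22) ^ n * (x11 * x21)) \<odot> left_f"

lemma x12_x21: "x12 * x21 = x11 * x22 - (1 :: 'k::comm_ring_1 sl2_ring)"
  using det_eq_1[where 'k = 'k] by (simp add: algebra_simps)

lemma left_e_power_t: "left_e ((x11 * x22) ^ n) =
  of_nat n * (x11 * x22) ^ (n - 1) * (x11 * (x21 :: 'k::field sl2_ring))"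
  by (simp add: vector_field_power[OF invariant_fields(1)] vector_field_mult[OF invariant_fields(1)])

text \<open>Bracket e with t^(n+1) f: since e(t) = x11 x21, differentiating the coefficient gives
  the F term, and [e,f] = h gives the H term.\<close>

lemma relation_F:
  "vf_scale (of_nat (Suc n)) (tF n) + tH (Suc n) \<in>
    (bracket_span :: ('k::field_char_0 sl2_ring \<Rightarrow> _) set)"
proof -
  let ?D = "coord_mono (Suc n) 0 0 (Suc n) \<odot> left_f :: 'k sl2_ring \<Rightarrow> _"
  have "weight (- 2) 0 ?D"
    using weight_coord_mono[OF weight_invariant_fields(3), of "Suc n" 0 0 "Suc n"] by simp
  moreover have "commutator left_e ?D = vf_scale (of_nat (Suc n)) (tF n) + tH (Suc n)"
    by (simp add: commutator_mult_field left_brackets coord_mono_def power_mult_distrib[symmetric]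
        left_e_power_t tF_def tH_def vf_scale_of_nat del: power_Suc of_nat_Suc)
      (simp add: mult_field_def fun_eq_iff vf_scale_numeral algebra_simps)
  ultimately show ?thesis using commutator_left_e_mem by metis
qed

lemma tH_0_mem: "(tH 0 :: 'k::field_char_0 sl2_ring \<Rightarrow> _) \<in> bracket_span"
  using commutator_left_e_mem[OF weight_invariant_fields(3)] by (simp add: tH_def left_brackets)

lemma left_e_tA: "left_e ((x11 * x22) ^ n * (x12 * x22)) =
  of_nat (n + 2) * (x11 * x22) ^ Suc n - of_nat (n + 1) * (x11 * (x22 :: 'k::field sl2_ring)) ^ n"
proof -
  \<comment> \<open>At \<open>n = 0\<close> the exponent \<open>n - 1\<close> is truncated, but both
    sides carry the factor 0.\<close>
  have "of_nat n * (x11 * x22) ^ (n - 1) * (x11 * x21) * (x12 * x22) =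
      of_nat n * (x11 * x22) ^ n * (x12 * (x21 :: 'k sl2_ring))"
    by (cases n) (simp_all add: algebra_simps)
  then have "left_e ((x11 * x22) ^ n * (x12 * x22)) =
      of_nat n * (x11 * x22) ^ n * (x12 * x21) + (x11 * x22) ^ n * (x11 * x22 + x12 * (x21 :: 'k sl2_ring))"
    by (simp add: vector_field_mult[OF invariant_fields(1), of "(x11 * x22) ^ n"] left_e_power_t)
      (simp add: vector_field_mult[OF invariant_fields(1)])
  then show ?thesis unfolding x12_x21 by (simp add: algebra_simps)
qed

text \<open>For g = t^n x12 x22, of weight (-2,0), [e, g h] = e(g) h - 2 g e.\<close>

lemma relation_H:
  "vf_scale (of_nat (n + 2)) (tH (Suc n)) - vf_scale (of_nat (n + 1)) (tH n) -
     vf_scale 2 (tE n) \<in> (bracket_span :: ('k::field_char_0 sl2_ring \<Rightarrow> _) set)"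
    (is "?r \<in> _")
proof -
  let ?D = "coord_mono n 1 0 (Suc n) \<odot> left_h :: 'k sl2_ring \<Rightarrow> _"
  have mono: "coord_mono n 1 0 (Suc n) = (x11 * x22) ^ n * (x12 * (x22 :: 'k sl2_ring))"
    by (simp add: coord_mono_def power_mult_distrib)
  have "weight (- 2) 0 ?D"
    using weight_coord_mono[OF weight_invariant_fields(2), of n 1 0 "Suc n"] by simp
  moreover have "commutator left_e ?D = ?r"
    unfolding mono
    by (simp add: commutator_mult_field left_brackets left_e_tA tE_def tH_def vf_scale_of_nat
        del: power_Suc of_nat_Suc of_nat_add)
      (simp add: mult_field_def fun_eq_iff vf_scale_numeral algebra_simps)
  ultimately show ?thesis using commutator_left_e_mem by metis
qed

text \<open>The source field t^n (x12 x22)^2 e has first weight -4 + 2 = -2. As [e,e] = 0, only the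
  derivative of the coefficient remains.\<close>

lemma relation_E:
  "vf_scale (of_nat (n + 4)) (tE (Suc n)) - vf_scale (of_nat (n + 2)) (tE n) \<in>
     (bracket_span :: ('k::field_char_0 sl2_ring \<Rightarrow> _) set)"
    (is "?r \<in> _")
proof -
  let ?D = "coord_mono n 2 0 (n + 2) \<odot> left_e :: 'k sl2_ring \<Rightarrow> _"
  have mono: "coord_mono n 2 0 (n + 2) = (x11 * x22) ^ n * (x12 * x22) * (x12 * (x22 :: 'k sl2_ring))"
    by (simp add: coord_mono_def power_mult_distrib power2_eq_square)
  have deriv: "left_e (x12 * x22) = 2 * (x11 * x22) - (1 :: 'k sl2_ring)"
    using x12_x21[where 'k = 'k] by (simp add: vector_field_mult[OF invariant_fields(1)] algebra_simps)
  have "weight (- 2) 0 ?D"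
    using weight_coord_mono[OF weight_invariant_fields(1), of n 2 0 "n + 2"] by simp
  moreover have "commutator left_e ?D = ?r"
    unfolding mono
    by (simp add: commutator_mult_field left_brackets tE_def vf_scale_of_nat
        vector_field_mult[OF invariant_fields(1), of "(x11 * x22) ^ n * (x12 * x22)"] left_e_tA deriv
        del: power_Suc of_nat_Suc of_nat_add)
      (simp add: mult_field_def fun_eq_iff vf_scale_numeral algebra_simps)
  ultimately show ?thesis using commutator_left_e_mem by metis
qed

text \<open>These are the coefficients of \<open>vector_field_decomposition\<close>: the entries
  (1,1), (1,2), (2,1) of X^{-1} h X are 2t - 1, 2 x12 x22 and -2 x11 x21.\<close>

lemma right_h_eq:
  "right_h = vf_scale 2 (tH 1) - tH 0 + vf_scale 2 (tE 0) -
    vf_scale 2 (tF 0 :: 'k::field sl2_ring \<Rightarrow> _)" (is "_ = ?D")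
proof (rule vector_field_eqI)
  have "tH n \<in> sl2_vector_fields" "tE n \<in> sl2_vector_fields"
    "(tF n :: 'k sl2_ring \<Rightarrow> _) \<in> sl2_vector_fields" for n
    unfolding tH_def tE_def tF_def by (simp_all add: mult_field_vector_field)
  then show "?D \<in> sl2_vector_fields"
    by (intro vf.subspace_diff vf.subspace_add subspace_vector_fields vf_scale_vector_field)
  have det: "x11 * x22 = 1 + x12 * (x21 :: 'k sl2_ring)"
    using x12_x21[where 'k = 'k] by (simp add: algebra_simps)
  \<comment> \<open>In sorted products \<open>x21\<close> separates \<open>x11\<close> from
    \<open>x22\<close>, so the determinant relation is also needed in this form.\<close>
  have "x11 * (x21 * (x22 * y)) = x21 * y * (x11 * x22)" for y :: "'k sl2_ring"
    by (simp add: ac_simps)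
  note det = det this[unfolded det]
  show "right_h x11 = ?D x11" "right_h x12 = ?D x12" "right_h x21 = ?D x21" "right_h x22 = ?D x22"
    by (simp_all add: tH_def tE_def tF_def mult_field_def vf_scale_numeral det algebra_simps)
qed simp

text \<open>Given \<open>tH 0\<close>, the recurrences at n = 0 tie \<open>tH 1\<close>,
  \<open>tE 0\<close>, \<open>tF 0\<close> by two relations; \<open>right_h\<close> supplies the
  third.\<close>

lemma tH_1_mem_tE_0_mem:
  "tH 1 \<in> (bracket_span :: ('k::field_char_0 sl2_ring \<Rightarrow> _) set)"
  "tE 0 \<in> (bracket_span :: ('k::field_char_0 sl2_ring \<Rightarrow> _) set)"
proof -
  note W = subspace_bracket_span[where 'a = 'k]
  let ?R = "vf_scale 2 (tH 1) - tH 0 + vf_scale 2 (tE 0) -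
    vf_scale 2 (tF 0) :: 'k sl2_ring \<Rightarrow> _"
  let ?F = "tF 0 + tH 1 :: 'k sl2_ring \<Rightarrow> _"
  let ?H = "vf_scale 2 (tH 1) - tH 0 - vf_scale 2 (tE 0) :: 'k sl2_ring \<Rightarrow> _"
  have R: "?R \<in> bracket_span" using right_h_mem by (simp add: right_h_eq)
  have F: "?F \<in> bracket_span" using relation_F[of 0] by simp
  have H: "?H \<in> bracket_span" using relation_H[of 0] by (simp add: One_nat_def)
  \<comment> \<open>\<open>tE 0\<close> cancels between \<open>?R\<close> and \<open>?H\<close>,
    \<open>tF 0\<close> between \<open>?R\<close> and \<open>?F\<close>, leaving only
    \<open>tH 1\<close>.\<close>
  have "?R + ?H + vf_scale 2 (tH 0) + vf_scale 2 ?F \<in> bracket_span"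
    by (intro vf.subspace_add[OF W] vf.subspace_scale[OF W] R H F tH_0_mem)
  also have "?R + ?H + vf_scale 2 (tH 0) + vf_scale 2 ?F = vf_scale 6 (tH 1)"
    by (simp add: fun_eq_iff vf_scale_numeral algebra_simps)
  finally show tH: "tH 1 \<in> (bracket_span :: ('k sl2_ring \<Rightarrow> _) set)"
    using bracket_span_cancel[of "6 :: 'k" "tH 1" 0] vf.subspace_0[OF W] by simp
  have "vf_scale 2 (tH 1) - tH 0 - ?H \<in> bracket_span"
    by (intro vf.subspace_diff[OF W] vf.subspace_scale[OF W] H tH tH_0_mem)
  then show "tE 0 \<in> (bracket_span :: ('k sl2_ring \<Rightarrow> _) set)"
    using bracket_span_cancel[of "2 :: 'k" "tE 0" 0] vf.subspace_0[OF W] by simp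
qed

text \<open>\<open>relation_E\<close> involves the E fields alone, so it is solved first;
  \<open>tH_mem\<close> builds on it, and \<open>tF_mem\<close> on \<open>tH_mem\<close>.\<close>

lemma tE_mem: "tE n \<in> (bracket_span :: ('k::field_char_0 sl2_ring \<Rightarrow> _) set)"
proof (induction n)
  case (Suc n)
  have "of_nat (n + 4) \<noteq> (0 :: 'k)" by (simp only: of_nat_eq_0_iff)
  moreover have "vf_scale (of_nat (n + 4)) (tE (Suc n)) + - vf_scale (of_nat (n + 2)) (tE n)
      \<in> (bracket_span :: ('k sl2_ring \<Rightarrow> _) set)"
    using relation_E[of n] by simp
  moreover have "- vf_scale (of_nat (n + 2)) (tE n) \<in> (bracket_span :: ('k sl2_ring \<Rightarrow> _) set)"
    by (intro vf.subspace_neg vf.subspace_scale subspace_bracket_span Suc)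
  ultimately show ?case by (rule bracket_span_cancel)
qed (rule tH_1_mem_tE_0_mem)

lemma tH_mem: "tH n \<in> (bracket_span :: ('k::field_char_0 sl2_ring \<Rightarrow> _) set)"
proof (induction n)
  case (Suc n)
  let ?E = "- vf_scale (of_nat (n + 1)) (tH n) - vf_scale 2 (tE n) :: 'k sl2_ring \<Rightarrow> _"
  have "of_nat (n + 2) \<noteq> (0 :: 'k)" by (simp only: of_nat_eq_0_iff)
  moreover have "vf_scale (of_nat (n + 2)) (tH (Suc n)) + ?E \<in> bracket_span"
    using relation_H[of n] by (simp add: algebra_simps)
  moreover have "?E \<in> bracket_span"
    by (intro vf.subspace_diff vf.subspace_neg vf.subspace_scale subspace_bracket_span Suc tE_mem)
  ultimately show ?case by (rule bracket_span_cancel)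
qed (rule tH_0_mem)

lemma tF_mem: "tF n \<in> (bracket_span :: ('k::field_char_0 sl2_ring \<Rightarrow> _) set)"
  by (rule bracket_span_cancel[OF _ relation_F tH_mem]) (simp only: of_nat_eq_0_iff)

section \<open>From the fields of weight (0,0) to all vector fields\<close>

lemma power_minus_1_mem:
  fixes D :: "'k::field_char_0 sl2_ring \<Rightarrow> 'k sl2_ring"
  assumes "\<And>n. g ^ n \<odot> D \<in> bracket_span"
  shows "(g ^ n * (g - 1) ^ m) \<odot> D \<in> bracket_span"
proof (induction m arbitrary: n)
  case (Suc m)
  \<comment> \<open>Splitting off one factor raises the power of \<open>g\<close> in one term, hence
    the induction for arbitrary \<open>n\<close>. It is applied with g = t, where t - 1 = x12
    x21.\<close>
  have "g ^ n * (g - 1) ^ Suc m = g ^ Suc n * (g - 1) ^ m - g ^ n * (g - 1) ^ m"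
    by (simp add: algebra_simps)
  then show ?case
    using vf.subspace_diff[OF subspace_bracket_span Suc Suc, of "Suc n" n]
    by (simp only: mult_field_diff_left)
qed (simp add: assms)

lemma mult_field_mem:
  fixes D :: "'k::field_char_0 sl2_ring \<Rightarrow> 'k sl2_ring"
  assumes "\<And>i j k l. coord_mono i j k l \<odot> D \<in> bracket_span"
  shows "g \<odot> D \<in> bracket_span"
proof (induction g rule: sl2_ring_induct)
  case zero
  have "0 \<odot> D = 0" by (simp add: mult_field_def fun_eq_iff)
  then show ?case using vf.subspace_0[OF subspace_bracket_span] by (simp only:)
next
  case (add f c i j k l)
  show ?case
    unfolding mult_field_add_left vf_scale_mult_field
    by (intro vf.subspace_add vf.subspace_scale subspace_bracket_span add assms)
qed

text \<open>Both weights vanish exactly when \<open>l = i\<close> and \<open>k = j\<close>; the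
  monomial is then t^i (t - 1)^j.\<close>

lemma coord_mono_left_h_mem:
  "coord_mono i j k l \<odot> left_h \<in> (bracket_span :: ('k::field_char_0 sl2_ring \<Rightarrow> _) set)"
proof (cases "l = i \<and> k = j")
  case True
  have "coord_mono i j j i = (x11 * x22) ^ i * (x12 * (x21 :: 'k sl2_ring)) ^ j"
    by (simp add: coord_mono_def power_mult_distrib)
  note this[unfolded x12_x21]
  with True show ?thesis
    using power_minus_1_mem[of "x11 * x22" left_h i j] tH_mem unfolding tH_def by metis
next
  case False
  then show ?thesis
    by (intro weight_nonzero_mem[OF weight_coord_mono[OF weight_invariant_fields(2)]]) arith
qed

text \<open>In weight (0,0) one factor \<open>x12 * x22\<close> remains besides powers of t and t -
  1, as in \<open>tE\<close>.\<close>

lemma coord_mono_left_e_mem: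
  "coord_mono i j k l \<odot> left_e \<in> (bracket_span :: ('k::field_char_0 sl2_ring \<Rightarrow> _) set)"
proof (cases "l = Suc i \<and> j = Suc k")
  case True
  have "coord_mono i (Suc k) k (Suc i) =
      (x11 * x22) ^ i * (x12 * (x21 :: 'k sl2_ring)) ^ k * (x12 * x22)"
    by (simp add: coord_mono_def power_mult_distrib)
  note this[unfolded x12_x21]
  with True show ?thesis
    using power_minus_1_mem[of "x11 * x22" "(x12 * x22) \<odot> left_e" i k] tE_mem
    unfolding tE_def mult_field_mult[symmetric] by metis
next
  case False
  then show ?thesis
    by (intro weight_nonzero_mem[OF weight_coord_mono[OF weight_invariant_fields(1)]]) arith
qed

text \<open>Here the remaining factor is \<open>x11 * x21\<close>, as in \<open>tF\<close>.\<close>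

lemma coord_mono_left_f_mem:
  "coord_mono i j k l \<odot> left_f \<in> (bracket_span :: ('k::field_char_0 sl2_ring \<Rightarrow> _) set)"
proof (cases "i = Suc l \<and> k = Suc j")
  case True
  have "coord_mono (Suc l) j (Suc j) l =
      (x11 * x22) ^ l * (x12 * (x21 :: 'k sl2_ring)) ^ j * (x11 * x21)"
    by (simp add: coord_mono_def power_mult_distrib)
  note this[unfolded x12_x21]
  with True show ?thesis
    using power_minus_1_mem[of "x11 * x22" "(x11 * x21) \<odot> left_f" l j] tF_mem
    unfolding tF_def mult_field_mult[symmetric] by metis
next
  case False
  then show ?thesis
    by (intro weight_nonzero_mem[OF weight_coord_mono[OF weight_invariant_fields(3)]]) arith
qed

text \<open>The three components in the frame e, h, f are treated separately. In particular the Lie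
  algebra equals its derived algebra.\<close>

theorem vector_field_mem_bracket_span:
  fixes D :: "'k::field_char_0 sl2_ring \<Rightarrow> 'k sl2_ring"
  assumes "D \<in> sl2_vector_fields"
  shows "D \<in> bracket_span"
  by (subst vector_field_decomposition[OF assms])
    (intro vf.subspace_add subspace_bracket_span mult_field_mem[OF coord_mono_left_h_mem]
      mult_field_mem[OF coord_mono_left_e_mem] mult_field_mem[OF coord_mono_left_f_mem])

section \<open>The bound on the bracket width\<close>

lemma derived_algebra_subset:
  "derived_algebra vf_scale commutator sl2_vector_fields \<subseteq> sl2_vector_fields"
  unfolding derived_algebra_def
  by (rule vf.span_minimal) (auto simp: commutator_vector_fields subspace_vector_fields)

lemma bracket_length_le_3:
  fixes D :: "'k::field_char_0 sl2_ring \<Rightarrow> 'k sl2_ring"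
  assumes "D \<in> sl2_vector_fields"
  shows "bracket_length commutator sl2_vector_fields D \<le> 3"
proof -
  obtain x y z where xyz:
    "D = commutator left_h x + commutator right_h y + commutator (left_e + right_e) z"
    "x \<in> sl2_vector_fields" "y \<in> sl2_vector_fields" "z \<in> sl2_vector_fields"
    using vector_field_mem_bracket_span[OF assms] unfolding bracket_span_def by blast
  \<comment> \<open>Lists turn the three pairs into families indexed by 0, 1, 2, the form used in
    \<open>bracket_length\<close>.\<close>
  define u where "u = nth [left_h, right_h, left_e + right_e :: 'k sl2_ring \<Rightarrow> _]"
  define v where "v = nth [x, y, z]"
  have "\<forall>i<3. u i \<in> sl2_vector_fields \<and> v i \<in> sl2_vector_fields"
    using xyz by (simp add: u_def v_def numeral_3_eq_3 All_less_Suc2 add_vector_field)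
  moreover have "D = (\<Sum>i<3. commutator (u i) (v i))"
    using xyz by (simp add: u_def v_def numeral_3_eq_3)
  ultimately have "bracket_length commutator sl2_vector_fields D \<le> enat 3"
    unfolding bracket_length_def by (intro Inf_lower) blast
  then show ?thesis by (simp add: numeral_eq_enat)
qed

theorem corollary3p8:
  "bracket_width vf_scale commutator
     (sl2_vector_fields :: ('k::field_char_0 sl2_ring \<Rightarrow> 'k sl2_ring) set) \<le> 3"
  unfolding bracket_width_def
  using derived_algebra_subset bracket_length_le_3 by (intro SUP_least) blast

end
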